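(* Let $n\ge3$ and $m=\frac{n-2}{n+2}$. For $\beta>0$, $\lambda>0$, let $u_{\beta,\lambda}$ denote the unique radially symmetric solution of $$\frac{n-1}{m}\Delta u^m+\beta\,x\cdot\nabla u+\frac{2\beta}{1-m}\,u=0\quad\text{on }\mathbb{R}^n$$ with $u_{\beta,\lambda}(0)=\lambda$. Then there exists a constant $\kappa=\kappa(n)\in\mathbb{R}$, depending only on the dimension $n$, such that for all $\beta,\lambda>0$, as $r=|x|\to\infty$, $$u_{\beta,\lambda}^{1-m}(r)=\frac{(n-1)(n-2)}{\beta r^2}\left\{\ln r+\left(\frac{2\ln\lambda}{n+2}+\frac{\ln\beta}{2}+\kappa(n)\right)+\frac{n-6}{4(n-2)}\,\frac{1}{\ln r}+o\!\left(\frac1{\ln r}\right)\right\}.$$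
   Context: Solutions are smooth, positive and entire on $\mathbb{R}^n$; a radial function is written as a function of $r=|x|$. It is known that for each $\beta>0$ and $\lambda>0$ such a radial solution exists and is uniquely determined by its value at the origin. Note $1-m=\frac{4}{n+2}$. *)

theory Defs
  imports "HOL-Analysis.Analysis" "HOL-Library.Landau_Symbols"
begin

definition partial_deriv :: "'n::finite \<Rightarrow> (real ^ 'n \<Rightarrow> real) \<Rightarrow> real ^ 'n \<Rightarrow> real" where
  "partial_deriv i f x = frechet_derivative f (at x) (axis i 1)"

definition gradient :: "(real ^ 'n::finite \<Rightarrow> real) \<Rightarrow> real ^ 'n \<Rightarrow> real ^ 'n" where
  "gradient f x = (\<chi> i. partial_deriv i f x)"

definition laplacian :: "(real ^ 'n::finite \<Rightarrow> real) \<Rightarrow> real ^ 'n \<Rightarrow> real" where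
  "laplacian f x = (\<Sum>i\<in>UNIV. partial_deriv i (partial_deriv i f) x)"

primrec C_diff :: "nat \<Rightarrow> (real ^ 'n::finite \<Rightarrow> real) \<Rightarrow> bool" where
  "C_diff 0 f \<longleftrightarrow> continuous_on UNIV f"
| "C_diff (Suc k) f \<longleftrightarrow> (\<forall>x. f differentiable (at x)) \<and> (\<forall>i. C_diff k (partial_deriv i f))"

definition smooth :: "(real ^ 'n::finite \<Rightarrow> real) \<Rightarrow> bool" where
  "smooth f \<longleftrightarrow> (\<forall>k. C_diff k f)"

text \<open>Smooth positive entire solutions of the elliptic equation. Since \<open>u\<close> is positive, the
  real power \<open>u powr m\<close> has its usual meaning.\<close>

definition entire_solution :: "real \<Rightarrow> real \<Rightarrow> (real ^ 'n::finite \<Rightarrow> real) \<Rightarrow> bool" where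
  "entire_solution m \<beta> u \<longleftrightarrow>
     smooth u \<and> (\<forall>x. u x > 0) \<and>
     (\<forall>x. (real CARD('n) - 1) / m * laplacian (\<lambda>y. u y powr m) x
           + \<beta> * (x \<bullet> gradient u x) + 2 * \<beta> / (1 - m) * u x = 0)"

text \<open>\<open>u\<close> is radially symmetric and \<open>U r\<close> is its value on the sphere of radius \<open>r \<ge> 0\<close>
  (values of \<open>U\<close> at negative arguments are irrelevant).\<close>

definition radial_profile :: "(real ^ 'n::finite \<Rightarrow> real) \<Rightarrow> (real \<Rightarrow> real) \<Rightarrow> bool" where
  "radial_profile u U \<longleftrightarrow> (\<forall>x. u x = U (norm x))"

end

theory Submission
  imports Defs
begin

text \<open>
  Put \<open>a = (n - 2) / 2\<close> and, in the cylindrical variable \<open>s = ln r\<close>,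
  \<open>W = \<beta> / (n - 1) * r\<^sup>2 * u powr (1 - m)\<close> and \<open>g = a + d (ln (u powr m)) / ds\<close>. The equation
  becomes the autonomous planar system \<open>W' = 2 / a * W * g\<close>, \<open>g' = a\<^sup>2 - W * g - g\<^sup>2\<close>, from which
  \<open>\<beta>\<close> has disappeared; \<open>u 0\<close> and \<open>\<beta>\<close> enter only through \<open>L = lim W / exp (2 * s)\<close> at \<open>-\<infinity>\<close>.
  The unstable manifold of \<open>(W, g) = (0, a)\<close> is a single orbit, so all solutions are translates of
  one another by \<open>ln L / 2\<close>; this gives the dependence of the constant term on \<open>\<beta>\<close> and \<open>\<lambda>\<close>.
  As \<open>s \<rightarrow> \<infinity>\<close>, the functions \<open>g\<close>, \<open>W * g\<close> and \<open>W\<^sup>2 * (W * g - a\<^sup>2)\<close> each solve a linear equation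
  \<open>h' = k - p * h\<close> with \<open>p \<rightarrow> \<infinity>\<close>, hence \<open>h\<close> has the limit of \<open>k / p\<close>. This yields \<open>W'\<close> up to
  \<open>o(1 / s\<^sup>2)\<close>, and integration gives the expansion.
\<close>

section \<open>Limits from differential equations\<close>

lemma filterlim_at_top_if_deriv_ge:
  fixes f f' :: "real \<Rightarrow> real"
  assumes deriv: "\<And>s. s \<ge> s0 \<Longrightarrow> (f has_real_derivative f' s) (at s)"
    and ge: "\<And>s. s \<ge> s0 \<Longrightarrow> f' s \<ge> c" and "c > 0"
  shows "filterlim f at_top at_top"
proof (rule filterlim_at_top_mono)
  show "filterlim (\<lambda>s. f s0 + c * (- s0 + s)) at_top at_top"
    by (intro filterlim_tendsto_add_at_top[OF tendsto_const] filterlim_ident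
        filterlim_tendsto_pos_mult_at_top[OF tendsto_const \<open>c > 0\<close>])
  show "\<forall>\<^sub>F s in at_top. f s0 + c * (- s0 + s) \<le> f s"
    using eventually_ge_at_top[of s0]
  proof eventually_elim
    case (elim s)
    have "f s0 - c * s0 \<le> f s - c * s"
    proof (rule DERIV_nonneg_imp_nondecreasing[OF elim])
      fix x assume "s0 \<le> x" "x \<le> s"
      then have "((\<lambda>s. f s - c * s) has_real_derivative f' x - c) (at x)" "0 \<le> f' x - c"
        using deriv[of x] ge[of x] by (auto intro!: derivative_eq_intros)
      then show "\<exists>y. ((\<lambda>s. f s - c * s) has_real_derivative y) (at x) \<and> 0 \<le> y"
        by blast
    qed
    then show ?case by (simp add: algebra_simps)
  qed
qed

text \<open>With an antiderivative \<open>\<Omega>\<close> of \<open>p\<close>, the product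
  \<open>h * exp \<Omega>\<close> has derivative \<open>k * exp \<Omega>\<close>, while
  \<open>exp \<Omega>\<close> has derivative \<open>p * exp \<Omega>\<close> and tends to infinity.
  L'Hospital's rule turns the limit of \<open>k / p\<close> into that of \<open>h\<close>.\<close>

lemma linear_ode_limit:
  fixes h k p :: "real \<Rightarrow> real"
  assumes deriv: "\<And>s. (h has_real_derivative k s - p s * h s) (at s)"
    and cont: "continuous_on UNIV p"
    and p: "filterlim p at_top at_top"
    and lim: "((\<lambda>s. k s / p s) \<longlongrightarrow> l) at_top"
  shows "(h \<longlongrightarrow> l) at_top"
proof -
  \<comment> \<open>For \<open>s < 0\<close> the interval is empty and the integral is 0, so
    \<open>\<Omega>\<close> serves as an antiderivative only for \<open>s > 0\<close>; the limit at
    infinity sees no more.\<close>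
  define \<Omega> where "\<Omega> = (\<lambda>s. integral {0..s} p)"
  have \<Omega>: "(\<Omega> has_real_derivative p s) (at s)" if "s > 0" for s
  proof -
    have "(\<Omega> has_real_derivative p s) (at s within {0..s + 1})"
      unfolding \<Omega>_def using that
      by (intro integral_has_real_derivative continuous_on_subset[OF cont]) auto
    then show ?thesis
      using that by (simp add: at_within_Icc_at)
  qed
  have pos: "\<forall>\<^sub>F s in at_top. p s \<ge> 1 \<and> s > 0"
    using p by (auto simp: filterlim_at_top eventually_conj_iff eventually_gt_at_top)
  then obtain s0 where s0: "\<And>s. s \<ge> s0 \<Longrightarrow> p s \<ge> 1 \<and> s > 0"
    by (auto simp: eventually_at_top_linorder)
  have "filterlim \<Omega> at_top at_top"
    by (rule filterlim_at_top_if_deriv_ge[of s0 _ p 1]) (use s0 \<Omega> in auto)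
  then have exp_top: "filterlim (\<lambda>s. exp (\<Omega> s)) at_top at_top"
    by (rule filterlim_compose[OF exp_at_top])
  have "((\<lambda>s. h s * exp (\<Omega> s) / exp (\<Omega> s)) \<longlongrightarrow> l) at_top"
  proof (rule lhospital_at_top_at_top[OF exp_top])
    show "\<forall>\<^sub>F s in at_top. exp (\<Omega> s) * p s \<noteq> 0"
      using pos by eventually_elim auto
    show "\<forall>\<^sub>F s in at_top. ((\<lambda>s. h s * exp (\<Omega> s)) has_real_derivative k s * exp (\<Omega> s)) (at s)"
      using pos
    proof eventually_elim
      case (elim s)
      then show ?case
        by (auto intro!: derivative_eq_intros deriv \<Omega> simp: algebra_simps)
    qed
    show "\<forall>\<^sub>F s in at_top. ((\<lambda>s. exp (\<Omega> s)) has_real_derivative exp (\<Omega> s) * p s) (at s)"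
      using pos by eventually_elim (auto intro!: derivative_eq_intros \<Omega>)
    show "((\<lambda>s. k s * exp (\<Omega> s) / (exp (\<Omega> s) * p s)) \<longlongrightarrow> l) at_top"
      using lim by (simp add: field_simps)
  qed
  then show ?thesis by simp
qed

text \<open>Since \<open>f'\<close> is close to K / s^2, adding \<open>(K + \<epsilon>) / s\<close>
  makes \<open>f\<close> eventually nonincreasing and adding \<open>(K - \<epsilon>) / s\<close>
  makes it eventually nondecreasing. The two monotone functions enclose the limit \<open>c\<close>
  and give the rate of convergence to it.\<close>

lemma tendsto_if_square_deriv_tendsto:
  fixes f f' :: "real \<Rightarrow> real"
  assumes deriv: "\<And>s. (f has_real_derivative f' s) (at s)"
    and lim: "((\<lambda>s. s\<^sup>2 * f' s) \<longlongrightarrow> K) at_top"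
  shows "\<exists>c. ((\<lambda>s. s * (f s - c)) \<longlongrightarrow> - K) at_top"
proof -
  have mono: "\<exists>s0>0. \<forall>s\<ge>s0. \<forall>t\<ge>s. f t + (K + \<epsilon>) / t \<le> f s + (K + \<epsilon>) / s \<and>
      f s + (K - \<epsilon>) / s \<le> f t + (K - \<epsilon>) / t" if "\<epsilon> > 0" for \<epsilon>
  proof -
    have "\<forall>\<^sub>F s in at_top. dist (s\<^sup>2 * f' s) K < \<epsilon> \<and> s > 0"
      using tendstoD[OF lim that] by (simp add: eventually_conj_iff eventually_gt_at_top)
    then obtain s0 where s0: "\<And>s. s \<ge> s0 \<Longrightarrow> \<bar>s\<^sup>2 * f' s - K\<bar> < \<epsilon> \<and> s > 0"
      by (auto simp: eventually_at_top_linorder dist_real_def)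
    have d: "((\<lambda>s. f s + c / s) has_real_derivative (s\<^sup>2 * f' s - c) / s\<^sup>2) (at s)"
      if "s \<ge> s0" for s c
      using s0[OF that]
      by (auto intro!: derivative_eq_intros deriv simp: field_simps power2_eq_square)
    have "f t + (K + \<epsilon>) / t \<le> f s + (K + \<epsilon>) / s \<and> f s + (K - \<epsilon>) / s \<le> f t + (K - \<epsilon>) / t"
      if "s \<ge> s0" "t \<ge> s" for s t
    proof
      show "f t + (K + \<epsilon>) / t \<le> f s + (K + \<epsilon>) / s"
      proof (rule DERIV_nonpos_imp_nonincreasing[OF \<open>t \<ge> s\<close>])
        fix x assume "s \<le> x"
        then have "x \<ge> s0" using that by simp
        moreover have "(x\<^sup>2 * f' x - (K + \<epsilon>)) / x\<^sup>2 \<le> 0"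
          using s0[OF \<open>x \<ge> s0\<close>] by (auto simp: divide_nonpos_pos abs_if split: if_splits)
        ultimately show "\<exists>y. ((\<lambda>s. f s + (K + \<epsilon>) / s) has_real_derivative y) (at x) \<and> y \<le> 0"
          using d by blast
      qed
      show "f s + (K - \<epsilon>) / s \<le> f t + (K - \<epsilon>) / t"
      proof (rule DERIV_nonneg_imp_nondecreasing[OF \<open>t \<ge> s\<close>])
        fix x assume "s \<le> x"
        then have "x \<ge> s0" using that by simp
        moreover have "(x\<^sup>2 * f' x - (K - \<epsilon>)) / x\<^sup>2 \<ge> 0"
          using s0[OF \<open>x \<ge> s0\<close>] by (auto simp: abs_if split: if_splits)
        ultimately show "\<exists>y. ((\<lambda>s. f s + (K - \<epsilon>) / s) has_real_derivative y) (at x) \<and> y \<ge> 0"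
          using d by blast
      qed
    qed
    then show ?thesis using s0[of s0] by auto
  qed
  have inv0: "((\<lambda>t. c / t) \<longlongrightarrow> 0) at_top" for c :: real
    by (rule tendsto_divide_0[OF tendsto_const]) (auto intro: filterlim_mono[OF filterlim_ident] simp: at_top_le_at_infinity)
  \<comment> \<open>Existence of the limit needs only \<epsilon> = 1: the nonincreasing function
    \<open>F\<close> lies above the nondecreasing one, hence is bounded below and converges to its
    infimum.\<close>
  obtain s1 where s1: "s1 > 0" "\<And>s t. s1 \<le> s \<Longrightarrow> s \<le> t \<Longrightarrow> f t + (K + 1) / t \<le> f s + (K + 1) / s \<and>
      f s + (K - 1) / s \<le> f t + (K - 1) / t"
    using mono[of 1] by auto
  define F where "F = (\<lambda>s. f s + (K + 1) / s)"
  define c where "c = Inf (F ` {s1..})"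
  have lower: "f s1 + (K - 1) / s1 \<le> F s" if "s \<ge> s1" for s
  proof -
    have "(K - 1) / s \<le> (K + 1) / s"
      using that s1(1) by (intro divide_right_mono) auto
    then show ?thesis using s1(2)[of s1 s] that by (auto simp: F_def)
  qed
  then have bdd: "bdd_below (F ` {s1..})"
    by (intro bdd_belowI[of _ "f s1 + (K - 1) / s1"]) auto
  have F_lim: "(F \<longlongrightarrow> c) at_top"
  proof (rule order_tendstoI)
    fix x assume "x < c"
    have "x < F s" if "s \<ge> s1" for s
      using cINF_lower[OF bdd, of s] that \<open>x < c\<close> by (auto simp: c_def)
    then show "\<forall>\<^sub>F s in at_top. x < F s"
      by (auto simp: eventually_at_top_linorder)
  next
    fix x assume "x > c"
    then obtain s where s: "s \<ge> s1" "F s < x"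
      using cInf_lessD[of "F ` {s1..}" x] by (auto simp: c_def)
    then have "F t < x" if "t \<ge> s" for t
      using s1(2)[of s t] that by (auto simp: F_def)
    then show "\<forall>\<^sub>F s in at_top. F s < x"
      by (auto simp: eventually_at_top_linorder)
  qed
  have f_lim: "(f \<longlongrightarrow> c) at_top"
    using tendsto_diff[OF F_lim inv0[of "K + 1"]] by (simp add: F_def)
  have "((\<lambda>s. s * (f s - c)) \<longlongrightarrow> - K) at_top"
  proof (rule tendstoI)
    fix \<epsilon> :: real assume "\<epsilon> > 0"
    then obtain s0 where s0: "s0 > 0" "\<And>s t. s0 \<le> s \<Longrightarrow> s \<le> t \<Longrightarrow>
      f t + (K + \<epsilon>/2) / t \<le> f s + (K + \<epsilon>/2) / s \<and> f s + (K - \<epsilon>/2) / s \<le> f t + (K - \<epsilon>/2) / t"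
      using mono[of "\<epsilon>/2"] by auto
    \<comment> \<open>Letting \<open>t\<close> tend to infinity in the two monotonicity inequalities
      replaces their values at \<open>t\<close> by \<open>c\<close>. The choice of \<epsilon> / 2
      yields the strict inequality.\<close>
    have "dist (s * (f s - c)) (- K) < \<epsilon>" if "s \<ge> s0" for s
    proof -
      have lims: "((\<lambda>t. f t + d / t) \<longlongrightarrow> c) at_top" for d
        using tendsto_add[OF f_lim inv0[of d]] by simp
      have "c \<le> f s + (K + \<epsilon>/2) / s"
        by (rule tendsto_upperbound[OF lims[of "K + \<epsilon>/2"]])
          (use s0(2)[OF that] in \<open>auto simp: eventually_at_top_linorder\<close>)
      moreover have "f s + (K - \<epsilon>/2) / s \<le> c"
        by (rule tendsto_lowerbound[OF lims[of "K - \<epsilon>/2"]])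
          (use s0(2)[OF that] in \<open>auto simp: eventually_at_top_linorder\<close>)
      ultimately have "s * (f s - c) + K \<le> \<epsilon>/2" "s * (f s - c) + K \<ge> - (\<epsilon>/2)"
        using s0(1) that by (auto simp: field_simps)
      then show ?thesis using \<open>\<epsilon> > 0\<close> by (auto simp: dist_real_def abs_if)
    qed
    then show "\<forall>\<^sub>F s in at_top. dist (s * (f s - c)) (- K) < \<epsilon>"
      by (auto simp: eventually_at_top_linorder)
  qed
  then show ?thesis by blast
qed

text \<open>Barrier principle: at the first point where \<open>f \<le> 0\<close> the value is 0 and
  the derivative is positive, so \<open>f\<close> would already be negative slightly to the
  left.\<close>

lemma pos_if_deriv_pos_at_zeros:
  fixes f f' :: "real \<Rightarrow> real"
  assumes deriv: "\<And>s. s \<ge> s0 \<Longrightarrow> (f has_real_derivative f' s) (at s)"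
    and zero: "\<And>s. s \<ge> s0 \<Longrightarrow> f s = 0 \<Longrightarrow> f' s > 0"
    and "f s0 > 0" "s \<ge> s0"
  shows "f s > 0"
proof (rule ccontr)
  assume neg: "\<not> f s > 0"
  have cont: "continuous_on {s0..s} f"
    by (rule DERIV_continuous_on[where D = f']) (auto intro: has_field_derivative_at_within deriv)
  have "closed {x \<in> {s0..s}. f x \<le> 0}"
    using continuous_closed_preimage[OF cont, of "{..0}"] by (simp add: vimage_def Int_def)
  moreover have "bounded {x \<in> {s0..s}. f x \<le> 0}"
    by (rule bounded_subset[OF bounded_closed_interval[of s0 s]]) auto
  ultimately have "compact {x \<in> {s0..s}. f x \<le> 0}"
    by (simp add: compact_eq_bounded_closed)
  moreover have "s \<in> {x \<in> {s0..s}. f x \<le> 0}"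
    using neg \<open>s \<ge> s0\<close> by auto
  ultimately obtain x where x: "s0 \<le> x" "x \<le> s" "f x \<le> 0"
    and first: "\<And>y. s0 \<le> y \<Longrightarrow> y \<le> s \<Longrightarrow> f y \<le> 0 \<Longrightarrow> x \<le> y"
    using compact_attains_inf[of "{x \<in> {s0..s}. f x \<le> 0}"] by auto
  have "x > s0" using x \<open>f s0 > 0\<close> by (cases "x = s0") auto
  have "f x = 0"
  proof -
    obtain y where "s0 \<le> y" "y \<le> x" "f y = 0"
      using IVT2'[of f x 0 s0] x \<open>f s0 > 0\<close> continuous_on_subset[OF cont, of "{s0..x}"] by auto
    then show ?thesis using first[of y] x by auto
  qed
  then have "f' x > 0" using zero x by simp
  then obtain d where d: "d > 0" "\<And>h. 0 < h \<Longrightarrow> h < d \<Longrightarrow> f (x - h) < f x"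
    using DERIV_pos_inc_left[OF deriv[OF x(1)]] by auto
  \<comment> \<open>Half of \<open>d\<close> keeps \<open>h\<close> strictly below \<open>d\<close>;
    the bound \<open>x - s0\<close> keeps \<open>x - h\<close> inside the interval on which
    \<open>x\<close> is the first point.\<close>
  define h where "h = min (d / 2) (x - s0)"
  have "0 < h" "h < d" "h \<le> x - s0" using d(1) \<open>x > s0\<close> by (auto simp: h_def)
  then show False
    using d(2)[of h] first[of "x - h"] \<open>f x = 0\<close> x by auto
qed

section \<open>The planar system\<close>

text \<open>An orbit leaving the saddle \<open>(W, g) = (0, a)\<close>, where the linearisation has
  eigenvalues 2 and - 2 * a. \<open>L\<close> fixes the time parametrisation. The constant in
  \<open>exp_bounds\<close> may depend on \<open>S\<close>; the rate \<open>exp s\<close> is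
  integrable at -\<infinity>, which is what the Gronwall argument for uniqueness uses.\<close>

locale orbit =
  fixes a L :: real and W g :: "real \<Rightarrow> real"
  assumes a_pos: "a > 0" and L_pos: "L > 0"
    and W_pos: "W s > 0"
    and W_deriv: "(W has_real_derivative 2 / a * W s * g s) (at s)"
    and g_deriv: "(g has_real_derivative a\<^sup>2 - W s * g s - (g s)\<^sup>2) (at s)"
    and W_lim: "((\<lambda>s. W s / exp (2 * s)) \<longlongrightarrow> L) at_bot"
    and exp_bounds: "\<exists>C. \<forall>s\<le>S. \<bar>g s - a\<bar> \<le> C * exp s \<and> W s \<le> C * exp s"
begin

section \<open>Positivity and boundedness of \<open>g\<close>, growth of \<open>W\<close>\<close>

lemma g_at_bot: "(g \<longlongrightarrow> a) at_bot"
proof -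
  obtain C where C: "\<And>s. s \<le> 0 \<Longrightarrow> \<bar>g s - a\<bar> \<le> C * exp s"
    using exp_bounds[of 0] by blast
  have "((\<lambda>s. C * exp s) \<longlongrightarrow> 0) at_bot"
    using tendsto_mult[OF tendsto_const exp_at_bot, of C] by simp
  moreover have "\<forall>\<^sub>F s in at_bot. norm (g s - a) \<le> C * exp s"
    using C by (auto simp: eventually_at_bot_linorder)
  ultimately have "((\<lambda>s. g s - a) \<longlongrightarrow> 0) at_bot"
    by (rule Lim_null_comparison[rotated])
  then show ?thesis by (simp add: LIM_zero_iff)
qed

text \<open>At a zero of \<open>g\<close> the equation reads \<open>g' = a\<^sup>2 > 0\<close>, so 0
  is a barrier; positivity starts near -\<infinity>, where \<open>g\<close> is close to
  \<open>a\<close>.\<close>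

lemma g_pos: "g s > 0"
proof -
  have "\<forall>\<^sub>F t in at_bot. g t > 0 \<and> t \<le> s"
    using order_tendstoD(1)[OF g_at_bot a_pos] by (simp add: eventually_conj_iff eventually_le_at_bot)
  then obtain t where "g t > 0" "t \<le> s"
    by (auto simp: eventually_at_bot_linorder)
  then show ?thesis
    by (rule pos_if_deriv_pos_at_zeros[OF g_deriv, rotated 1]) (use a_pos in auto)
qed

text \<open>A level \<open>M > a\<close> is an upper barrier: there \<open>g'\<close> is at most a^2
  - M^2 < 0 because \<open>W * g > 0\<close>.\<close>

lemma g_bounded: "\<exists>M. \<forall>s\<ge>0. g s < M"
proof -
  define M where "M = max (g 0) a + 1"
  have M: "M > a" by (simp add: M_def)
  have "M - g s > 0" if "s \<ge> 0" for s
  proof (rule pos_if_deriv_pos_at_zeros[of 0 "\<lambda>s. M - g s", OF _ _ _ that])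
    show "((\<lambda>s. M - g s) has_real_derivative - (a\<^sup>2 - W s * g s - (g s)\<^sup>2)) (at s)" for s
      by (auto intro!: derivative_eq_intros g_deriv)
    show "- (a\<^sup>2 - W s * g s - (g s)\<^sup>2) > 0" if "M - g s = 0" for s
    proof -
      have "a\<^sup>2 < (g s)\<^sup>2"
        using M a_pos that by (intro power_strict_mono) auto
      then show ?thesis using mult_pos_pos[OF W_pos g_pos, of s s] by linarith
    qed
  qed (auto simp: M_def)
  then show ?thesis by (intro exI[of _ M]) auto
qed

lemma ln_W_deriv: "((\<lambda>s. ln (W s)) has_real_derivative 2 / a * g s) (at s)"
  using DERIV_chain2[OF DERIV_ln_divide[OF W_pos[of s]] W_deriv] W_pos[of s]
  by simp

lemma W_mono:
  assumes "s \<le> t"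
  shows "W s \<le> W t"
proof (rule DERIV_nonneg_imp_nondecreasing[OF assms])
  fix x
  have "2 / a * W x * g x \<ge> 0"
    using a_pos W_pos[of x] g_pos[of x] by simp
  then show "\<exists>y. (W has_real_derivative y) (at x) \<and> 0 \<le> y"
    using W_deriv by blast
qed

text \<open>If \<open>W \<le> M\<close>, a small \<open>c > 0\<close> is a lower barrier for
  \<open>g\<close>, since \<open>a\<^sup>2 - M * c - c\<^sup>2\<close> tends to
  \<open>a\<^sup>2 > 0\<close> as \<open>c\<close> tends to 0. Then \<open>ln W\<close> grows at
  least linearly, contradicting the bound.\<close>

lemma W_unbounded: "\<exists>s. W s > M"
proof (rule ccontr)
  assume "\<nexists>s. W s > M"
  then have M: "W s \<le> M" for s by (auto simp: not_less)
  have "M > 0" using W_pos[of 0] M[of 0] by linarith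
  have "((\<lambda>c. a\<^sup>2 - M * c - c\<^sup>2) \<longlongrightarrow> a\<^sup>2 - M * 0 - 0\<^sup>2) (at_right 0)"
    by (intro tendsto_intros)
  then have "\<forall>\<^sub>F c in at_right 0. a\<^sup>2 - M * c - c\<^sup>2 > 0"
    by (rule order_tendstoD) (use a_pos in auto)
  moreover have "\<forall>\<^sub>F c in at_right 0. 0 < c \<and> c < g 0"
    using eventually_at_right_real[OF g_pos[of 0]] by eventually_elim auto
  ultimately have "\<forall>\<^sub>F c in at_right (0::real). 0 < c \<and> c < g 0 \<and> a\<^sup>2 - M * c - c\<^sup>2 > 0"
    by eventually_elim auto
  then obtain c where c: "0 < c" "c < g 0" "a\<^sup>2 - M * c - c\<^sup>2 > 0"
    using eventually_happens'[OF trivial_limit_at_right_real] by blast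
  have g_ge: "g s > c" if "s \<ge> 0" for s
  proof -
    have "g s - c > 0"
    proof (rule pos_if_deriv_pos_at_zeros[of 0 "\<lambda>s. g s - c", OF _ _ _ that])
      show "((\<lambda>s. g s - c) has_real_derivative a\<^sup>2 - W s * g s - (g s)\<^sup>2) (at s)" for s
        by (auto intro!: derivative_eq_intros g_deriv)
      show "a\<^sup>2 - W s * g s - (g s)\<^sup>2 > 0" if "g s - c = 0" for s
      proof -
        have "g s = c" using that by simp
        moreover have "W s * c \<le> M * c"
          using c by (intro mult_right_mono M) simp
        ultimately show ?thesis using c(3) by simp
      qed
    qed (use c in auto)
    then show ?thesis by simp
  qed
  have "filterlim (\<lambda>s. ln (W s)) at_top at_top"
  proof (rule filterlim_at_top_if_deriv_ge[OF ln_W_deriv])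
    show "2 / a * c \<le> 2 / a * g s" if "s \<ge> 0" for s
      using g_ge[OF that] a_pos by (intro mult_left_mono) auto
    show "2 / a * c > 0" using a_pos c by simp
  qed
  then have "\<forall>\<^sub>F s in at_top. ln (W s) > ln M"
    by (simp add: filterlim_at_top_dense)
  then obtain s where "ln (W s) > ln M"
    by (auto simp: eventually_at_top_linorder)
  moreover have "ln (W s) \<le> ln M" using M[of s] W_pos[of s] by simp
  ultimately show False by simp
qed

lemma W_at_top: "filterlim W at_top at_top"
  unfolding filterlim_at_top eventually_at_top_linorder
proof
  fix M
  obtain s where "W s > M" using W_unbounded by blast
  then show "\<exists>N. \<forall>t\<ge>N. W t \<ge> M" using W_mono[of s] by (intro exI[of _ s]) force
qed

lemma W_cont: "continuous_on A W"
  using W_deriv by (intro continuous_at_imp_continuous_on) (auto intro: DERIV_isCont)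

lemma g_cont: "continuous_on A g"
  using g_deriv by (intro continuous_at_imp_continuous_on) (auto intro: DERIV_isCont)

lemma bounded_div_W:
  assumes "\<forall>\<^sub>F s in at_top. \<bar>f s\<bar> \<le> M"
  shows "((\<lambda>s. f s / W s) \<longlongrightarrow> 0) at_top"
proof (rule Lim_null_comparison)
  show "\<forall>\<^sub>F s in at_top. norm (f s / W s) \<le> M / W s"
    using assms by eventually_elim (simp add: W_pos abs_of_pos divide_right_mono order_less_imp_le)
  show "((\<lambda>s. M / W s) \<longlongrightarrow> 0) at_top"
    by (intro tendsto_divide_0[OF tendsto_const] filterlim_at_top_imp_at_infinity W_at_top)
qed

section \<open>Asymptotics of \<open>g\<close>, \<open>W * g\<close> and \<open>W\<close> at
  infinity\<close>

text \<open>Here \<open>p = W\<close> and \<open>k = a\<^sup>2 - g\<^sup>2\<close> is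
  bounded.\<close>

lemma g_lim: "(g \<longlongrightarrow> 0) at_top"
proof (rule linear_ode_limit[OF _ W_cont W_at_top])
  show "(g has_real_derivative (a\<^sup>2 - (g s)\<^sup>2) - W s * g s) (at s)" for s
    using g_deriv[of s] by (simp add: algebra_simps)
  obtain M where M: "\<And>s. s \<ge> 0 \<Longrightarrow> g s < M" using g_bounded by blast
  show "((\<lambda>s. (a\<^sup>2 - (g s)\<^sup>2) / W s) \<longlongrightarrow> 0) at_top"
  proof (rule bounded_div_W[where M = "a\<^sup>2 + M\<^sup>2"])
    have "\<bar>a\<^sup>2 - (g s)\<^sup>2\<bar> \<le> a\<^sup>2 + M\<^sup>2" if "s \<ge> 0" for s
    proof -
      have "(g s)\<^sup>2 \<le> M\<^sup>2"
        using M[OF that] g_pos[of s] by (intro power_mono) auto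
      then show ?thesis using zero_le_power2[of a] zero_le_power2[of "g s"] by linarith
    qed
    then show "\<forall>\<^sub>F s in at_top. \<bar>a\<^sup>2 - (g s)\<^sup>2\<bar> \<le> a\<^sup>2 + M\<^sup>2"
      by (auto simp: eventually_at_top_linorder)
  qed
qed

lemma g_div_W: "((\<lambda>s. c * g s / W s) \<longlongrightarrow> 0) at_top"
  by (rule tendsto_divide_0[OF _ filterlim_at_top_imp_at_infinity[OF W_at_top]])
    (use tendsto_mult[OF tendsto_const g_lim, of c] in simp)

text \<open>The next two linear equations have coefficients \<open>p\<close> of this form, with
  \<open>c = 2 / a - 1\<close> and \<open>c = 4 / a\<close>. As \<open>g\<close> tends to 0, they
  are asymptotic to \<open>W\<close>.\<close>

lemma coeff_at_top: "filterlim (\<lambda>s. W s - c * g s) at_top at_top"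
proof -
  have "filterlim (\<lambda>s. - c * g s + W s) at_top at_top"
    using tendsto_mult[OF tendsto_const g_lim, of "- c"]
    by (rule filterlim_tendsto_add_at_top) (rule W_at_top)
  then show ?thesis by (simp add: algebra_simps)
qed

lemma W_div_coeff: "((\<lambda>s. W s / (W s - c * g s)) \<longlongrightarrow> 1) at_top"
proof -
  have "((\<lambda>s. 1 / (1 - c * g s / W s)) \<longlongrightarrow> 1 / (1 - 0)) at_top"
    by (intro tendsto_intros g_div_W) auto
  moreover have "1 / (1 - c * g s / W s) = W s / (W s - c * g s)" for s
    using W_pos[of s] by (simp add: field_simps)
  ultimately show ?thesis by simp
qed

lemma Wg_deriv: "((\<lambda>s. W s * g s) has_real_derivative
    W s * (a\<^sup>2 - W s * g s) + (2 / a - 1) * W s * (g s)\<^sup>2) (at s)"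
  by (rule derivative_eq_intros W_deriv g_deriv refl)+ (simp add: algebra_simps power2_eq_square)

lemma Wg_lim: "((\<lambda>s. W s * g s) \<longlongrightarrow> a\<^sup>2) at_top"
proof (rule linear_ode_limit[OF _ _ coeff_at_top])
  show "((\<lambda>s. W s * g s) has_real_derivative
      a\<^sup>2 * W s - (W s - (2 / a - 1) * g s) * (W s * g s)) (at s)" for s
    using Wg_deriv[of s] by (simp add: algebra_simps power2_eq_square)
  show "continuous_on UNIV (\<lambda>s. W s - (2 / a - 1) * g s)"
    by (intro continuous_intros W_cont g_cont)
  show "((\<lambda>s. a\<^sup>2 * W s / (W s - (2 / a - 1) * g s)) \<longlongrightarrow> a\<^sup>2) at_top"
    using tendsto_mult[OF tendsto_const W_div_coeff, of "a\<^sup>2" "2 / a - 1"] by simp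
qed

text \<open>For \<open>H = W * g - a\<^sup>2\<close> one has
  \<open>H' = - W * H + (2 / a - 1) * W * g\<^sup>2\<close>. Balancing the two terms suggests that
  \<open>H\<close> is close to \<open>(2 / a - 1) * g\<^sup>2\<close>, of order W^(-2), whence the
  weight \<open>W\<^sup>2\<close>. Differentiating the weight changes the coefficient to
  \<open>W - 4 / a * g\<close>.\<close>

lemma Wg_correction: "((\<lambda>s. (W s)\<^sup>2 * (W s * g s - a\<^sup>2)) \<longlongrightarrow> (2 / a - 1) * a ^ 4) at_top"
proof (rule linear_ode_limit[OF _ _ coeff_at_top])
  show "((\<lambda>s. (W s)\<^sup>2 * (W s * g s - a\<^sup>2)) has_real_derivative
      (2 / a - 1) * (W s * g s)\<^sup>2 * W s -
      (W s - 4 / a * g s) * ((W s)\<^sup>2 * (W s * g s - a\<^sup>2))) (at s)" for s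
  proof -
    have "((\<lambda>s. (W s)\<^sup>2 * (W s * g s - a\<^sup>2)) has_real_derivative
        2 * W s * (2 / a * W s * g s) * (W s * g s - a\<^sup>2) +
        (W s * (a\<^sup>2 - W s * g s) + (2 / a - 1) * W s * (g s)\<^sup>2) * (W s)\<^sup>2) (at s)"
      by (rule derivative_eq_intros Wg_deriv W_deriv refl)+ simp
    then show ?thesis
      by (rule DERIV_cong) (use a_pos in \<open>simp add: field_simps power2_eq_square\<close>)
  qed
  show "continuous_on UNIV (\<lambda>s. W s - 4 / a * g s)"
    by (intro continuous_intros W_cont g_cont)
  have "((\<lambda>s. (2 / a - 1) * (W s * g s)\<^sup>2 * (W s / (W s - 4 / a * g s)))
      \<longlongrightarrow> (2 / a - 1) * (a\<^sup>2)\<^sup>2 * 1) at_top"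
    by (intro tendsto_intros Wg_lim W_div_coeff)
  then show "((\<lambda>s. (2 / a - 1) * (W s * g s)\<^sup>2 * W s / (W s - 4 / a * g s))
      \<longlongrightarrow> (2 / a - 1) * a ^ 4) at_top"
    by simp
qed

lemma W_div_id: "((\<lambda>s. W s / s) \<longlongrightarrow> 2 * a) at_top"
proof (rule lhospital_at_top_at_top)
  show "\<forall>\<^sub>F s in at_top. (W has_real_derivative 2 / a * W s * g s) (at s)"
    using W_deriv by (intro always_eventually) auto
  show "((\<lambda>s. 2 / a * W s * g s / 1) \<longlongrightarrow> 2 * a) at_top"
    using tendsto_mult[OF tendsto_const Wg_lim, of "2 / a"] a_pos
    by (simp add: power2_eq_square mult.assoc)
qed (auto intro: filterlim_ident)

text \<open>The derivative of \<open>W / (2 * a) - s\<close> is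
  \<open>(W * g - a\<^sup>2) / a\<^sup>2\<close>. Since \<open>W\<close> grows like
  \<open>2 * a * s\<close>, the preceding correction becomes a limit after multiplication by
  \<open>s\<^sup>2\<close>, namely \<open>(2 / a - 1) / 4\<close>.\<close>

lemma W_asymptotics:
  "\<exists>c. ((\<lambda>s. s * (W s / (2 * a) - s - c)) \<longlongrightarrow> - (2 / a - 1) / 4) at_top"
proof -
  have "\<exists>c. ((\<lambda>s. s * ((W s / (2 * a) - s) - c)) \<longlongrightarrow> - ((2 / a - 1) / 4)) at_top"
  proof (rule tendsto_if_square_deriv_tendsto)
    show "((\<lambda>s. W s / (2 * a) - s) has_real_derivative (W s * g s - a\<^sup>2) / a\<^sup>2) (at s)" for s
      using a_pos by (auto intro!: derivative_eq_intros W_deriv simp: field_simps power2_eq_square)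
    have "((\<lambda>s. (W s)\<^sup>2 * (W s * g s - a\<^sup>2) / (W s / s)\<^sup>2 / a\<^sup>2)
        \<longlongrightarrow> (2 / a - 1) * a ^ 4 / (2 * a)\<^sup>2 / a\<^sup>2) at_top"
      using a_pos by (intro tendsto_intros Wg_correction W_div_id) auto
    also have "(2 / a - 1) * a ^ 4 / (2 * a)\<^sup>2 / a\<^sup>2 = (2 / a - 1) / 4"
      using a_pos by (simp add: field_simps eval_nat_numeral)
    \<comment> \<open>The equality of functions includes \<open>s = 0\<close>, where division by 0
      makes both sides 0.\<close>
    also have "(\<lambda>s. (W s)\<^sup>2 * (W s * g s - a\<^sup>2) / (W s / s)\<^sup>2 / a\<^sup>2) =
        (\<lambda>s. s\<^sup>2 * ((W s * g s - a\<^sup>2) / a\<^sup>2))"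
      using W_pos by (auto simp: fun_eq_iff power_divide less_imp_neq[THEN not_sym])
    finally show "((\<lambda>s. s\<^sup>2 * ((W s * g s - a\<^sup>2) / a\<^sup>2)) \<longlongrightarrow> (2 / a - 1) / 4) at_top" .
  qed
  then show ?thesis by (simp only: minus_divide_left)
qed

end

section \<open>Uniqueness of the orbit\<close>

text \<open>The integrating factor \<open>exp (- K * exp s)\<close> tends to 1 at -\<infinity>, so
  its product with \<open>E\<close> still tends to 0 there, and it is nonincreasing.\<close>

lemma gronwall_at_bot:
  fixes E E' :: "real \<Rightarrow> real"
  assumes deriv: "\<And>s. s \<le> S \<Longrightarrow> (E has_real_derivative E' s) (at s)"
    and le: "\<And>s. s \<le> S \<Longrightarrow> E' s \<le> K * exp s * E s"
    and lim: "(E \<longlongrightarrow> 0) at_bot"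
  shows "E S \<le> 0"
proof -
  define F where "F = (\<lambda>s. E s * exp (- K * exp s))"
  have F_ge: "F S \<le> F s" if "s \<le> S" for s
  proof (rule DERIV_nonpos_imp_nonincreasing[OF that])
    fix x assume "x \<le> S"
    then have "(F has_real_derivative (E' x - K * exp x * E x) * exp (- K * exp x)) (at x)"
      unfolding F_def by (auto intro!: derivative_eq_intros deriv simp: algebra_simps)
    moreover have "(E' x - K * exp x * E x) * exp (- K * exp x) \<le> 0"
      using le[OF \<open>x \<le> S\<close>] by (simp add: mult_le_0_iff)
    ultimately show "\<exists>y. (F has_real_derivative y) (at x) \<and> y \<le> 0" by blast
  qed
  have "((\<lambda>s. E s * exp (- K * exp s)) \<longlongrightarrow> 0 * exp (- K * 0)) at_bot"
    by (intro tendsto_intros lim exp_at_bot)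
  then have "(F \<longlongrightarrow> 0) at_bot" by (simp add: F_def)
  then have "F S \<le> 0"
    by (rule tendsto_lowerbound) (use F_ge in \<open>auto simp: eventually_at_bot_linorder\<close>)
  then show ?thesis by (simp add: F_def mult_le_0_iff)
qed

text \<open>Consequence of \<open>ln t \<le> t - 1\<close> at \<open>t = y / x\<close>. It bounds a
  difference of \<open>W\<close>s by the difference of logarithms, with a factor that decays at
  -\<infinity>.\<close>

lemma diff_le_mult_ln_diff:
  fixes x y :: real
  assumes "x > 0" "y > 0"
  shows "\<bar>x - y\<bar> \<le> max x y * \<bar>ln x - ln y\<bar>"
proof -
  have *: "x - y \<le> x * (ln x - ln y)" if "x > 0" "y > 0" for x y :: real
    using ln_le_minus_one[of "y / x"] that by (simp add: ln_div field_simps)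
  show ?thesis
  proof (cases "x \<ge> y")
    case True
    then have "ln x \<ge> ln y" using assms by simp
    then show ?thesis using True *[OF assms] by simp
  next
    case False
    then have "ln x \<le> ln y" using assms by simp
    then show ?thesis using False *[OF assms(2,1)] by simp
  qed
qed

text \<open>The system is autonomous; only the normalisation against \<open>exp (2 * s)\<close>
  notices the shift.\<close>

lemma (in orbit) orbit_shift: "orbit a (L * exp (2 * t)) (\<lambda>s. W (s + t)) (\<lambda>s. g (s + t))"
proof
  fix s
  show "((\<lambda>s. W (s + t)) has_real_derivative 2 / a * W (s + t) * g (s + t)) (at s)"
    using W_deriv[of "s + t"] by (simp add: DERIV_shift)
  show "((\<lambda>s. g (s + t)) has_real_derivative a\<^sup>2 - W (s + t) * g (s + t) - (g (s + t))\<^sup>2) (at s)"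
    using g_deriv[of "s + t"] by (simp add: DERIV_shift)
next
  have "filterlim (\<lambda>s. s + t) at_bot at_bot"
    unfolding filterlim_at_bot eventually_at_bot_linorder by (metis le_diff_eq)
  from filterlim_compose[OF W_lim this]
  have "((\<lambda>s. W (s + t) / exp (2 * (s + t)) * exp (2 * t)) \<longlongrightarrow> L * exp (2 * t)) at_bot"
    by (intro tendsto_intros)
  then show "((\<lambda>s. W (s + t) / exp (2 * s)) \<longlongrightarrow> L * exp (2 * t)) at_bot"
    by (simp add: distrib_left exp_add)
next
  fix S
  obtain C where C: "\<And>s. s \<le> S + t \<Longrightarrow> \<bar>g s - a\<bar> \<le> C * exp s \<and> W s \<le> C * exp s"
    using exp_bounds[of "S + t"] by blast
  have "\<bar>g (s + t) - a\<bar> \<le> (C * exp t) * exp s \<and> W (s + t) \<le> (C * exp t) * exp s"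
    if "s \<le> S" for s
    using C[of "s + t"] that by (simp add: exp_add mult_ac)
  then show "\<exists>C. \<forall>s\<le>S. \<bar>g (s + t) - a\<bar> \<le> C * exp s \<and> W (s + t) \<le> C * exp s"
    by blast
qed (use a_pos L_pos W_pos in auto)

text \<open>Equal \<open>L\<close> makes the differences of \<open>ln W\<close> and of
  \<open>g\<close> vanish at -\<infinity>. In the coordinates \<open>z\<close>, \<open>e\<close> the
  linear part is \<open>z' = 0\<close>, \<open>e' = - 2 * a * e\<close>, which cannot increase
  \<open>z\<^sup>2 + e\<^sup>2\<close>; all other terms are O(exp s) times the size of
  \<open>(z, e)\<close>, so Gronwall's inequality applies.\<close>

lemma orbit_unique:
  assumes "orbit a L W1 g1" "orbit a L W2 g2"
  shows "W1 = W2"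
proof
  fix S
  interpret o1: orbit a L W1 g1 by fact
  interpret o2: orbit a L W2 g2 by fact
  note a_pos = o1.a_pos
  define d where "d = (\<lambda>s. ln (W1 s) - ln (W2 s))"
  define e where "e = (\<lambda>s. g1 s - g2 s)"
  \<comment> \<open>The linearisation \<open>d' = 2 / a * e\<close>, \<open>e' = - 2 * a * e\<close> at \<open>-\<infinity>\<close> conserves \<open>d + e / a\<^sup>2\<close>.\<close>
  define z where "z = (\<lambda>s. d s + e s / a\<^sup>2)"
  define e' where "e' = (\<lambda>s. - (W1 s + g1 s + g2 s) * e s - g2 s * (W1 s - W2 s))"
  define z' where "z' = (\<lambda>s. ((2 * a - g1 s - g2 s - W1 s) * e s - g2 s * (W1 s - W2 s)) / a\<^sup>2)"
  define E where "E = (\<lambda>s. (z s)\<^sup>2 + (e s)\<^sup>2)"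
  have e_deriv: "(e has_real_derivative e' s) (at s)" for s
    unfolding e_def e'_def
    by (rule derivative_eq_intros o1.g_deriv o2.g_deriv refl)+
      (simp add: algebra_simps power2_eq_square)
  have z_deriv: "(z has_real_derivative z' s) (at s)" for s
  proof -
    have "(z has_real_derivative 2 / a * g1 s - 2 / a * g2 s + e' s / a\<^sup>2) (at s)"
      unfolding z_def d_def
      by (intro derivative_intros DERIV_cdivide o1.ln_W_deriv o2.ln_W_deriv e_deriv)
    then show ?thesis
      using a_pos by (rule_tac DERIV_cong)
        (auto simp: z'_def e'_def e_def field_simps power2_eq_square)
  qed
  have E_deriv: "(E has_real_derivative 2 * z s * z' s + 2 * e s * e' s) (at s)" for s
    unfolding E_def by (auto intro!: derivative_eq_intros e_deriv z_deriv)
  have e_lim: "(e \<longlongrightarrow> 0) at_bot"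
    using tendsto_diff[OF o1.g_at_bot o2.g_at_bot] by (simp add: e_def)
  have d_lim: "(d \<longlongrightarrow> 0) at_bot"
  proof -
    \<comment> \<open>The factors \<open>exp (2 * s)\<close> cancel in the difference of logarithms;
      this is where the common value of \<open>L\<close> enters.\<close>
    have "((\<lambda>s. ln (W1 s / exp (2 * s)) - ln (W2 s / exp (2 * s))) \<longlongrightarrow> ln L - ln L) at_bot"
      using o1.L_pos by (intro tendsto_intros o1.W_lim o2.W_lim) auto
    then show ?thesis
      using o1.W_pos o2.W_pos by (simp add: d_def ln_div less_imp_neq[THEN not_sym])
  qed
  have E_lim: "(E \<longlongrightarrow> 0) at_bot"
  proof -
    have "(E \<longlongrightarrow> (0 + 0 / a\<^sup>2)\<^sup>2 + 0\<^sup>2) at_bot"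
      unfolding E_def z_def using a_pos by (intro tendsto_intros d_lim e_lim) auto
    then show ?thesis by simp
  qed
  obtain C1 where C1: "\<And>s. s \<le> S \<Longrightarrow> \<bar>g1 s - a\<bar> \<le> C1 * exp s \<and> W1 s \<le> C1 * exp s"
    using o1.exp_bounds[of S] by blast
  obtain C2 where C2: "\<And>s. s \<le> S \<Longrightarrow> \<bar>g2 s - a\<bar> \<le> C2 * exp s \<and> W2 s \<le> C2 * exp s"
    using o2.exp_bounds[of S] by blast
  define C where "C = max C1 C2"
  define B where "B = a + C * exp S"
  define M where "M = 1 + 1 / a\<^sup>2"
  have "C1 > 0"
    using C1[of S] o1.W_pos[of S] by (smt (verit) exp_gt_zero mult_nonpos_nonneg order_refl)
  then have "C > 0" by (simp add: C_def)
  then have "B > 0" using a_pos by (simp add: B_def add_pos_pos)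
  have "M > 0" by (simp add: M_def add_pos_nonneg)
  \<comment> \<open>With \<open>t = C * exp s\<close> and \<open>r = sqrt (E s)\<close>, the bounds
    below are \<open>g2 \<le> B\<close>, \<open>\<bar>d\<bar> \<le> M * r\<close> and hence
    \<open>\<bar>W1 - W2\<bar> \<le> t * M * r\<close>. The two summands of \<open>K\<close> come
    from \<open>z * z'\<close> and \<open>e * e'\<close>.\<close>
  define K where "K = 2 * ((3 * C + B * C * M) / a\<^sup>2 + B * C * M)"
  have E_le: "2 * z s * z' s + 2 * e s * e' s \<le> K * exp s * E s" if "s \<le> S" for s
  proof -
    define t where "t = C * exp s"
    have "t > 0" using \<open>C > 0\<close> by (simp add: t_def)
    have Ct: "C1 * exp s \<le> t" "C2 * exp s \<le> t"
      by (simp_all add: t_def C_def mult_right_mono)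
    have W1: "0 < W1 s" "W1 s \<le> t" and W2: "0 < W2 s" "W2 s \<le> t"
      and g1: "0 < g1 s" "\<bar>g1 s - a\<bar> \<le> t" and g2: "0 < g2 s" "\<bar>g2 s - a\<bar> \<le> t"
      using C1[OF that] C2[OF that] Ct o1.W_pos o2.W_pos o1.g_pos o2.g_pos
      by (auto intro: order_trans)
    have "t \<le> C * exp S"
      using \<open>C > 0\<close> that by (simp add: t_def)
    then have g2_le: "g2 s \<le> B" using g2 by (simp add: B_def)
    have abs_le: "\<bar>z s\<bar> \<le> sqrt (E s)" "\<bar>e s\<bar> \<le> sqrt (E s)"
      by (auto simp: E_def real_le_rsqrt)
    have "E s \<ge> 0" by (simp add: E_def)
    define r where "r = sqrt (E s)"
    have r: "r \<ge> 0" "r * r = E s" using \<open>E s \<ge> 0\<close> by (auto simp: r_def)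
    have ze: "\<bar>z s\<bar> \<le> r" "\<bar>e s\<bar> \<le> r" using abs_le by (auto simp: r_def)
    have "d s = z s - e s / a\<^sup>2" by (simp add: z_def)
    then have "\<bar>d s\<bar> \<le> \<bar>z s\<bar> + \<bar>e s\<bar> / a\<^sup>2"
      using abs_triangle_ineq4[of "z s" "e s / a\<^sup>2"] by simp
    also have "\<dots> \<le> r + r / a\<^sup>2"
      using ze by (intro add_mono divide_right_mono) auto
    also have "\<dots> = M * r" by (simp add: M_def field_simps)
    finally have d: "\<bar>d s\<bar> \<le> M * r" .
    have "\<bar>W1 s - W2 s\<bar> \<le> max (W1 s) (W2 s) * \<bar>d s\<bar>"
      unfolding d_def using W1(1) W2(1) by (rule diff_le_mult_ln_diff)
    also have "\<dots> \<le> t * (M * r)"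
      using W1 W2 d \<open>t > 0\<close> by (intro mult_mono) auto
    finally have "\<bar>W1 s - W2 s\<bar> \<le> t * (M * r)" .
    then have gW: "\<bar>g2 s * (W1 s - W2 s)\<bar> \<le> B * (t * (M * r))"
      unfolding abs_mult using g2 g2_le \<open>B > 0\<close> by (intro mult_mono) auto
    \<comment> \<open>Each of \<open>a - g1\<close>, \<open>a - g2\<close> and \<open>W1\<close> is
      at most \<open>t\<close> in absolute value.\<close>
    have "\<bar>(2 * a - g1 s - g2 s - W1 s) * e s\<bar> \<le> 3 * t * r"
      unfolding abs_mult using g1 g2 W1 ze by (intro mult_mono) auto
    then have "\<bar>(2 * a - g1 s - g2 s - W1 s) * e s - g2 s * (W1 s - W2 s)\<bar>
        \<le> 3 * t * r + B * (t * (M * r))"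
      using gW by linarith
    then have "\<bar>z' s\<bar> \<le> (3 * t * r + B * (t * (M * r))) / a\<^sup>2"
      unfolding z'_def abs_divide using a_pos by (simp add: divide_right_mono)
    then have "\<bar>z s\<bar> * \<bar>z' s\<bar> \<le> r * ((3 * t * r + B * (t * (M * r))) / a\<^sup>2)"
      using ze r by (intro mult_mono) auto
    then have zz: "z s * z' s \<le> r * ((3 * t * r + B * (t * (M * r))) / a\<^sup>2)"
      using abs_ge_self[of "z s * z' s"] by (simp add: abs_mult)
    have "\<bar>e s\<bar> * \<bar>g2 s * (W1 s - W2 s)\<bar> \<le> r * (B * (t * (M * r)))"
      using ze gW r by (intro mult_mono) auto
    then have "- (e s * (g2 s * (W1 s - W2 s))) \<le> r * (B * (t * (M * r)))"
      using abs_ge_minus_self[of "e s * (g2 s * (W1 s - W2 s))"] by (simp add: abs_mult)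
    \<comment> \<open>The first term is damping: it is nonpositive, so only the term with
      \<open>W1 - W2\<close> has to be estimated.\<close>
    moreover have "e s * e' s = - ((W1 s + g1 s + g2 s) * (e s)\<^sup>2) - e s * (g2 s * (W1 s - W2 s))"
      by (simp add: e'_def algebra_simps power2_eq_square)
    moreover have "(W1 s + g1 s + g2 s) * (e s)\<^sup>2 \<ge> 0"
      using W1 g1 g2 by simp
    ultimately have "e s * e' s \<le> r * (B * (t * (M * r)))" by linarith
    with zz have "2 * (z s * z' s) + 2 * (e s * e' s) \<le>
        2 * (r * ((3 * t * r + B * (t * (M * r))) / a\<^sup>2)) + 2 * (r * (B * (t * (M * r))))"
      by simp
    also have "\<dots> = 2 * ((3 * t + B * t * M) / a\<^sup>2 + B * t * M) * (r * r)"
      by (simp add: field_simps)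
    also have "\<dots> = K * exp s * E s"
      unfolding r(2) by (simp add: K_def t_def field_simps)
    finally show ?thesis by (simp add: mult.assoc)
  qed
  have "E S \<le> 0"
    by (rule gronwall_at_bot[OF E_deriv E_le E_lim])
  moreover have "(z S)\<^sup>2 \<ge> 0" "(e S)\<^sup>2 \<ge> 0" by auto
  ultimately have "(z S)\<^sup>2 = 0" "(e S)\<^sup>2 = 0"
    unfolding E_def by linarith+
  then have "d S = 0" by (simp add: z_def)
  then show "W1 S = W2 S"
    using o1.W_pos[of S] o2.W_pos[of S] by (simp add: d_def)
qed

section \<open>Translation of orbits and the common constant\<close>

text \<open>A shift by \<open>- ln L / 2\<close> multiplies \<open>L\<close> by
  \<open>exp (- ln L) = 1 / L\<close>, so both orbits are normalised to \<open>L = 1\<close> and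
  coincide.\<close>

lemma orbit_shift_unique:
  assumes "orbit a L1 W1 g1" "orbit a L2 W2 g2"
  shows "W1 (s - ln L1 / 2) = W2 (s - ln L2 / 2)"
proof -
  have "orbit a (L * exp (2 * (- ln L / 2))) (\<lambda>s. W (s + (- ln L / 2))) (\<lambda>s. g (s + (- ln L / 2)))"
    if "orbit a L W g" for L W g
    using that by (rule orbit.orbit_shift)
  moreover have "L * exp (2 * (- ln L / 2)) = 1" if "orbit a L W g" for L W g
    using orbit.L_pos[OF that] by (simp add: exp_minus)
  ultimately have "orbit a 1 (\<lambda>s. W (s + (- ln L / 2))) (\<lambda>s. g (s + (- ln L / 2)))"
    if "orbit a L W g" for L W g
    using that by metis
  then have "(\<lambda>s. W1 (s + (- ln L1 / 2))) = (\<lambda>s. W2 (s + (- ln L2 / 2)))"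
    using assms by (intro orbit_unique)
  then show ?thesis by (simp add: fun_eq_iff)
qed

text \<open>Each orbit has its own constant \<open>c\<close>. Writing it as the translate by
  \<open>\<tau>\<close> of a reference orbit \<open>W0\<close> gives \<open>c = c0 + \<tau>\<close>,
  so \<open>c - ln L / 2\<close> is the same for all orbits with the given \<open>a\<close>.\<close>

lemma orbit_asymptotics:
  "\<exists>\<kappa>. \<forall>L W g. orbit a L W g \<longrightarrow>
    ((\<lambda>s. s * (W s / (2 * a) - s - (ln L / 2 + \<kappa>))) \<longlongrightarrow> - (2 / a - 1) / 4) at_top"
proof (cases "\<exists>L W g. orbit a L W g")
  case True
  then obtain L0 W0 g0 where o0: "orbit a L0 W0 g0" by blast
  have inv: "((\<lambda>s::real. 1 / s) \<longlongrightarrow> 0) at_top"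
    using tendsto_inverse_0_at_top[OF filterlim_ident] by (simp add: divide_inverse)
  have limit: "((\<lambda>s. W s / (2 * a) - s) \<longlongrightarrow> c) at_top"
    if "((\<lambda>s. s * (W s / (2 * a) - s - c)) \<longlongrightarrow> k) at_top" for W c k
  proof -
    have "((\<lambda>s. s * (W s / (2 * a) - s - c) * (1 / s) + c) \<longlongrightarrow> k * 0 + c) at_top"
      by (intro tendsto_intros that inv)
    moreover have "\<forall>\<^sub>F s in at_top. s * (W s / (2 * a) - s - c) * (1 / s) + c = W s / (2 * a) - s"
      using eventually_gt_at_top[of 0] by eventually_elim simp
    ultimately show ?thesis by (simp add: tendsto_cong)
  qed
  obtain c0 where c0: "((\<lambda>s. s * (W0 s / (2 * a) - s - c0)) \<longlongrightarrow> - (2 / a - 1) / 4) at_top"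
    using orbit.W_asymptotics[OF o0] by blast
  show ?thesis
  proof (intro exI[of _ "c0 - ln L0 / 2"] allI impI)
    fix L W g assume o: "orbit a L W g"
    obtain c where c: "((\<lambda>s. s * (W s / (2 * a) - s - c)) \<longlongrightarrow> - (2 / a - 1) / 4) at_top"
      using orbit.W_asymptotics[OF o] by blast
    define \<tau> where "\<tau> = ln L / 2 - ln L0 / 2"
    have shift: "filterlim (\<lambda>s::real. s + \<tau>) at_top at_top"
      using filterlim_tendsto_add_at_top[OF tendsto_const filterlim_ident, of \<tau>]
      by (simp add: add.commute)
    have "W s = W0 (s + \<tau>)" for s
      using orbit_shift_unique[OF o o0, of "s + ln L / 2"] by (simp add: \<tau>_def algebra_simps)
    then have "((\<lambda>s. W s / (2 * a) - s - \<tau>) \<longlongrightarrow> c0) at_top"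
      using filterlim_compose[OF limit[OF c0] shift] by (simp add: algebra_simps)
    moreover have "((\<lambda>s. W s / (2 * a) - s - \<tau>) \<longlongrightarrow> c - \<tau>) at_top"
      by (intro tendsto_intros limit[OF c])
    ultimately have "c0 = c - \<tau>"
      by (rule tendsto_unique[OF trivial_limit_at_top_linorder])
    then have "ln L / 2 + (c0 - ln L0 / 2) = c" by (simp add: \<tau>_def)
    then show "((\<lambda>s. s * (W s / (2 * a) - s - (ln L / 2 + (c0 - ln L0 / 2))))
        \<longlongrightarrow> - (2 / a - 1) / 4) at_top"
      using c by simp
  qed
qed auto

section \<open>From the elliptic equation to the planar system\<close>

lemma has_derivative_of_norm:
  fixes x :: "'a::real_inner"
  assumes "(\<Phi> has_real_derivative d) (at (norm x))" "x \<noteq> 0"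
  shows "((\<lambda>y. \<Phi> (norm y)) has_derivative (\<lambda>v. d * (x \<bullet> v / norm x))) (at x)"
proof -
  have "(norm has_derivative (\<lambda>v. v \<bullet> sgn x)) (at x)"
    using \<open>x \<noteq> 0\<close> has_derivative_norm by blast
  from has_derivative_compose[OF this, of \<Phi> "(*) d"] assms(1)
  have "((\<lambda>y. \<Phi> (norm y)) has_derivative (\<lambda>v. d * (v \<bullet> sgn x))) (at x)"
    by (simp add: has_field_derivative_def)
  then show ?thesis
    by (simp add: sgn_div_norm inner_commute divide_inverse mult_ac)
qed

lemma partial_deriv_eq:
  assumes "(f has_derivative f') (at x)"
  shows "partial_deriv i f x = f' (axis i 1)"
  using frechet_derivative_at[OF assms] by (simp add: partial_deriv_def)

text \<open>With \<open>h r = \<Phi>' r / r\<close> the first partials are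
  \<open>h (norm y) * y $ i\<close>. Differentiating once more and summing over \<open>i\<close>,
  the squares of the coordinates add up to \<open>(norm x)\<^sup>2\<close>.\<close>

lemma laplacian_radial:
  fixes F :: "real ^ 'n::finite \<Rightarrow> real"
  assumes F: "\<And>y. F y = \<Phi> (norm y)"
    and \<Phi>: "\<And>r. r > 0 \<Longrightarrow> (\<Phi> has_real_derivative \<Phi>' r) (at r)"
    and \<Phi>': "\<And>r. r > 0 \<Longrightarrow> (\<Phi>' has_real_derivative \<Phi>'' r) (at r)"
    and "x \<noteq> 0"
  shows "laplacian F x = \<Phi>'' (norm x) + (real CARD('n) - 1) / norm x * \<Phi>' (norm x)"
proof -
  define h where "h = (\<lambda>r. \<Phi>' r / r)"
  define h' where "h' = (\<lambda>r. (\<Phi>'' r - h r) / r)"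
  have h: "(h has_real_derivative h' r) (at r)" if "r > 0" for r
    unfolding h_def h'_def using that
    by (auto intro!: derivative_eq_intros \<Phi>' simp: field_simps)
  have first: "partial_deriv i F y = h (norm y) * (y $ i)" if "y \<noteq> 0" for y i
  proof -
    have "(F has_derivative (\<lambda>v. \<Phi>' (norm y) * (y \<bullet> v / norm y))) (at y)"
      unfolding F[abs_def] using that by (intro has_derivative_of_norm \<Phi>) auto
    from partial_deriv_eq[OF this] show ?thesis
      by (simp add: h_def inner_axis)
  qed
  have second: "partial_deriv i (partial_deriv i F) x =
      h' (norm x) / norm x * (x $ i)\<^sup>2 + h (norm x)" for i
  proof -
    have nth: "((\<lambda>y::real ^ 'n. y $ i) has_derivative (\<lambda>v. v $ i)) (at x)"
      by (intro bounded_linear_imp_has_derivative bounded_linear_vec_nth)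
    have "((\<lambda>y. h (norm y) * (y $ i)) has_derivative
        (\<lambda>v. h (norm x) * (v $ i) + h' (norm x) * (x \<bullet> v / norm x) * (x $ i))) (at x)"
      using \<open>x \<noteq> 0\<close> by (intro has_derivative_mult has_derivative_of_norm h nth) auto
    then have "(partial_deriv i F has_derivative
        (\<lambda>v. h (norm x) * (v $ i) + h' (norm x) * (x \<bullet> v / norm x) * (x $ i))) (at x)"
      \<comment> \<open>The formula for the first partials is known off the origin, an open set
        containing \<open>x\<close>, and so may be differentiated there.\<close>
      by (rule has_derivative_transform_within_open[of _ _ _ _ "- {0}"])
        (use \<open>x \<noteq> 0\<close> first in auto)
    from partial_deriv_eq[OF this] show ?thesis
      by (simp add: inner_axis power2_eq_square)
  qed
  have "(\<Sum>i\<in>UNIV. (x $ i)\<^sup>2) = (norm x)\<^sup>2"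
    by (simp add: norm_vec_def L2_set_def sum_nonneg)
  moreover have "laplacian F x = h' (norm x) / norm x * (\<Sum>i\<in>UNIV. (x $ i)\<^sup>2) + CARD('n) * h (norm x)"
    unfolding laplacian_def second by (simp only: sum.distrib sum_distrib_left sum_constant)
  ultimately have "laplacian F x = h' (norm x) / norm x * (norm x)\<^sup>2 + CARD('n) * h (norm x)"
    by simp
  also have "\<dots> = \<Phi>'' (norm x) + (real CARD('n) - 1) / norm x * \<Phi>' (norm x)"
    using \<open>x \<noteq> 0\<close> by (simp add: h_def h'_def field_simps power2_eq_square)
  finally show ?thesis .
qed

text \<open>Restricting to a line through the origin yields a profile that is differentiable across
  \<open>t = 0\<close> too, which the behaviour of the orbit at -\<infinity> requires.\<close>

lemma C_diff_line_derivative: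
  fixes f :: "real ^ 'n::finite \<Rightarrow> real"
  assumes "C_diff (Suc k) f"
  shows "((\<lambda>t. f (t *\<^sub>R axis i 1)) has_real_derivative partial_deriv i f (t *\<^sub>R axis i 1)) (at t)"
proof -
  let ?x = "t *\<^sub>R axis i (1::real) :: real ^ 'n"
  have "(f has_derivative frechet_derivative f (at ?x)) (at ?x)"
    using assms by (simp add: frechet_derivative_works)
  moreover have "((\<lambda>t. t *\<^sub>R axis i 1) has_derivative (\<lambda>h. h *\<^sub>R (axis i 1 :: real ^ 'n))) (at t)"
    by (auto intro!: derivative_eq_intros)
  ultimately have "((\<lambda>t. f (t *\<^sub>R axis i 1)) has_derivative
      (\<lambda>h. frechet_derivative f (at ?x) (h *\<^sub>R axis i 1))) (at t)"
    by (rule has_derivative_compose[rotated])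
  moreover have "linear (frechet_derivative f (at ?x))"
    using assms by (simp add: linear_frechet_derivative)
  ultimately show ?thesis
    by (simp add: has_field_derivative_def partial_deriv_def linear_scale mult.commute[of _ "frechet_derivative f (at ?x) (axis i 1)"])
qed

lemma inner_gradient_axis:
  "(r *\<^sub>R axis i 1) \<bullet> gradient f x = r * partial_deriv i f x"
  by (simp add: gradient_def inner_axis' )


section \<open>The logarithmic substitution\<close>

text \<open>\<open>G\<close> is the logarithmic derivative of \<open>\<phi> powr m\<close>, so
  \<open>exp s * G (exp s)\<close> is its derivative in \<open>s = ln r\<close>. The equation for
  \<open>W\<close> rests on \<open>(1 - m) * a = 2 * m\<close>; that for \<open>g\<close> is
  \<open>r\<^sup>2\<close> times the radial equation, with the square completed by
  \<open>N - 2 = 2 * a\<close>.\<close>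

lemma orbit_of_radial_ode:
  fixes N m a \<beta> :: real and \<phi> \<phi>' G G' :: "real \<Rightarrow> real"
  assumes "N > 2" and m: "m = (N - 2) / (N + 2)" and a: "a = (N - 2) / 2" and "\<beta> > 0"
    and \<phi>_pos: "\<And>r. \<phi> r > 0"
    and \<phi>_deriv: "\<And>r. (\<phi> has_real_derivative \<phi>' r) (at r)"
    and \<phi>'_cont: "continuous_on UNIV \<phi>'"
    and G: "\<And>r. G r = m * \<phi>' r / \<phi> r"
    and G_deriv: "\<And>r. r > 0 \<Longrightarrow> (G has_real_derivative G' r) (at r)"
    and ode: "\<And>r. r > 0 \<Longrightarrow> G' r + (G r)\<^sup>2 + (N - 1) / r * G r +
      \<beta> / (N - 1) * \<phi> r powr (1 - m) * (r * G r + a) = 0"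
  shows "orbit a (\<beta> / (N - 1) * \<phi> 0 powr (1 - m))
    (\<lambda>s. \<beta> / (N - 1) * exp (2 * s) * \<phi> (exp s) powr (1 - m)) (\<lambda>s. a + exp s * G (exp s))"
proof -
  define b where "b = \<beta> / (N - 1)"
  define W where "W = (\<lambda>s. b * exp (2 * s) * \<phi> (exp s) powr (1 - m))"
  have "b > 0" "a > 0" "m > 0"
    using \<open>N > 2\<close> \<open>\<beta> > 0\<close> by (auto simp: b_def a m field_simps)
  have am: "(1 - m) * a = 2 * m"
    using \<open>N > 2\<close> by (simp add: a m field_simps)
  have \<phi>_cont: "continuous_on A \<phi>" for A
    using \<phi>_deriv by (intro continuous_at_imp_continuous_on) (auto intro: DERIV_isCont)
  have G_cont: "continuous_on A G" for A
    unfolding G[abs_def] using \<phi>_pos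
    by (intro continuous_intros \<phi>_cont continuous_on_subset[OF \<phi>'_cont])
      (auto simp: less_imp_neq[THEN not_sym])
  have powr_cont: "continuous_on A (\<lambda>r. \<phi> r powr (1 - m))" for A
    using \<phi>_pos by (intro continuous_intros \<phi>_cont) (auto simp: less_imp_neq[THEN not_sym])
  have "orbit a (b * \<phi> 0 powr (1 - m)) W (\<lambda>s. a + exp s * G (exp s))"
  proof
    fix s
    show "W s > 0" using \<open>b > 0\<close> \<phi>_pos[of "exp s"] by (simp add: W_def)
    define r where "r = exp s"
    have "r > 0" by (simp add: r_def)
    have "(W has_real_derivative W s * (2 + (1 - m) * (r * \<phi>' r / \<phi> r))) (at s)"
    proof -
      have "((\<lambda>s. \<phi> (exp s)) has_real_derivative \<phi>' r * r) (at s)"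
        unfolding r_def by (rule DERIV_chain2[OF \<phi>_deriv DERIV_exp])
      then have "((\<lambda>s. \<phi> (exp s) powr (1 - m)) has_real_derivative
          (1 - m) * \<phi> r powr (1 - m - 1) * (\<phi>' r * r)) (at s)"
        using DERIV_fun_powr[of "\<lambda>s. \<phi> (exp s)" _ s "1 - m"] \<phi>_pos by (simp add: r_def)
      moreover have "\<phi> r powr (1 - m - 1) = \<phi> r powr (1 - m) / \<phi> r"
        using powr_diff[of "\<phi> r" "1 - m" 1] \<phi>_pos[of r] by simp
      ultimately have "((\<lambda>s. \<phi> (exp s) powr (1 - m)) has_real_derivative
          \<phi> r powr (1 - m) * ((1 - m) * (r * \<phi>' r / \<phi> r))) (at s)"
        by (simp add: mult_ac)
      moreover have "((\<lambda>s. b * exp (2 * s)) has_real_derivative b * exp (2 * s) * 2) (at s)"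
        by (auto intro!: derivative_eq_intros)
      ultimately show ?thesis
        unfolding W_def by (rule DERIV_cong[OF DERIV_mult[rotated]]) (simp add: r_def algebra_simps)
    qed
    moreover have "2 + (1 - m) * (r * \<phi>' r / \<phi> r) = 2 / a * (a + r * G r)"
    proof -
      have "2 / a * (a + r * G r) = 2 + 2 * m / a * (r * \<phi>' r / \<phi> r)"
        using \<open>a > 0\<close> by (simp add: G field_simps)
      also have "2 * m / a = 1 - m" using am \<open>a > 0\<close> by (simp add: field_simps)
      finally show ?thesis by simp
    qed
    ultimately show "(W has_real_derivative 2 / a * W s * (a + exp s * G (exp s))) (at s)"
      by (simp add: r_def mult_ac)
    have "((\<lambda>s. G (exp s)) has_real_derivative G' r * r) (at s)"
      unfolding r_def by (rule DERIV_chain2[OF G_deriv DERIV_exp]) simp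
    then have "((\<lambda>s. a + exp s * G (exp s)) has_real_derivative r * G r + r\<^sup>2 * G' r) (at s)"
      by (auto intro!: derivative_eq_intros simp: r_def power2_eq_square)
    moreover have "r * G r + r\<^sup>2 * G' r = a\<^sup>2 - W s * (a + r * G r) - (a + r * G r)\<^sup>2"
    proof -
      have Ws: "W s = b * r\<^sup>2 * \<phi> r powr (1 - m)"
        by (simp add: W_def r_def exp_double)
      have "r\<^sup>2 * (G' r + (G r)\<^sup>2 + (N - 1) / r * G r + b * \<phi> r powr (1 - m) * (r * G r + a)) = 0"
        using ode[OF \<open>r > 0\<close>] by (simp add: b_def)
      also have "r\<^sup>2 * (G' r + (G r)\<^sup>2 + (N - 1) / r * G r + b * \<phi> r powr (1 - m) * (r * G r + a)) =
          r\<^sup>2 * G' r + (r * G r)\<^sup>2 + (N - 1) * (r * G r) + W s * (a + r * G r)"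
        unfolding Ws using \<open>r > 0\<close> by (simp add: field_simps power2_eq_square)
      finally have "r\<^sup>2 * G' r = - (r * G r)\<^sup>2 - (N - 1) * (r * G r) - W s * (a + r * G r)"
        by simp
      moreover have "N - 1 = 2 * a + 1" by (simp add: a field_simps)
      ultimately show ?thesis by (simp add: algebra_simps power2_eq_square)
    qed
    ultimately show "((\<lambda>s. a + exp s * G (exp s)) has_real_derivative
        a\<^sup>2 - W s * (a + exp s * G (exp s)) - (a + exp s * G (exp s))\<^sup>2) (at s)"
      by (simp add: r_def)
  next
    have "isCont (\<lambda>r. \<phi> r powr (1 - m)) 0"
      using powr_cont[of UNIV] by (simp add: continuous_on_eq_continuous_at)
    note tendsto_mult[OF tendsto_const isCont_tendsto_compose[OF this exp_at_bot], of b]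
    then have "((\<lambda>s. b * \<phi> (exp s) powr (1 - m)) \<longlongrightarrow> b * \<phi> 0 powr (1 - m)) at_bot" .
    then show "((\<lambda>s. W s / exp (2 * s)) \<longlongrightarrow> b * \<phi> 0 powr (1 - m)) at_bot"
      by (simp add: W_def)
  next
    fix S :: real
    define R :: real where "R = exp S"
    \<comment> \<open>\<open>G\<close> and \<open>\<phi> powr (1 - m)\<close> are continuous on the
      compact interval from 0 to \<open>exp S\<close>, the origin included. The bounds keep one
      factor \<open>exp s\<close>; the second one in \<open>W\<close> is absorbed by
      \<open>R\<close>.\<close>
    have bound: "\<exists>M. \<forall>r\<in>{0..R}. \<bar>f r\<bar> \<le> M" if "continuous_on {0..R} f" for f :: "real \<Rightarrow> real"
      using compact_imp_bounded[OF compact_continuous_image[OF that compact_Icc]]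
      by (auto simp: bounded_iff)
    obtain M1 where M1: "\<And>r. r \<in> {0..R} \<Longrightarrow> \<bar>G r\<bar> \<le> M1"
      using bound[OF G_cont] by blast
    obtain M2 where M2: "\<And>r. r \<in> {0..R} \<Longrightarrow> \<bar>b * R * \<phi> r powr (1 - m)\<bar> \<le> M2"
      using bound[OF continuous_on_mult_left[OF powr_cont, where c = "b * R"]] by blast
    have "\<bar>a + exp s * G (exp s) - a\<bar> \<le> max M1 M2 * exp s \<and> W s \<le> max M1 M2 * exp s"
      if "s \<le> S" for s
    proof
      have s: "exp s \<in> {0..R}" using that by (simp add: R_def)
      show "\<bar>a + exp s * G (exp s) - a\<bar> \<le> max M1 M2 * exp s"
        using M1[OF s] by (simp add: abs_mult mult.commute[of "exp s"] mult_right_mono)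
      have "b * exp s * \<phi> (exp s) powr (1 - m) \<le> b * R * \<phi> (exp s) powr (1 - m)"
        using s \<open>b > 0\<close> by (intro mult_right_mono mult_left_mono) auto
      also have "\<dots> \<le> max M1 M2" using M2[OF s] by linarith
      finally have "b * exp s * \<phi> (exp s) powr (1 - m) * exp s \<le> max M1 M2 * exp s"
        by (intro mult_right_mono) auto
      moreover have "W s = b * exp s * \<phi> (exp s) powr (1 - m) * exp s"
        using exp_add[of s s] by (simp add: W_def)
      ultimately show "W s \<le> max M1 M2 * exp s" by simp
    qed
    then show "\<exists>C. \<forall>s\<le>S. \<bar>a + exp s * G (exp s) - a\<bar> \<le> C * exp s \<and> W s \<le> C * exp s"
      by blast
  qed (use \<open>a > 0\<close> \<open>b > 0\<close> \<phi>_pos[of 0] in auto)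
  then show ?thesis by (simp add: W_def b_def)
qed


text \<open>Along one coordinate axis the equation becomes an ordinary one for
  \<open>\<phi>\<close>. Expressed through \<open>\<Phi> = \<phi> powr m\<close> and
  \<open>G\<close>, every term contains the factor \<open>\<Phi>\<close>, which is positive and can
  be divided out.\<close>

lemma orbit_of_entire_solution:
  fixes u :: "real ^ 'n::finite \<Rightarrow> real"
  defines "N \<equiv> real CARD('n)"
  assumes "N > 2" and m: "m = (N - 2) / (N + 2)" and a: "a = (N - 2) / 2" and "\<beta> > 0"
    and sol: "entire_solution m \<beta> u" and rad: "radial_profile u U"
  shows "\<exists>W g. orbit a (\<beta> / (N - 1) * u 0 powr (1 - m)) W g \<and>
    (\<forall>s. W s = \<beta> / (N - 1) * exp (2 * s) * U (exp s) powr (1 - m))"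
proof -
  obtain i :: 'n where "i \<in> UNIV" by simp
  define e :: "real ^ 'n" where "e = axis i 1"
  have norm_e: "norm e = 1" by (simp add: e_def)
  have smooth: "C_diff k u" for k
    using sol by (simp add: entire_solution_def smooth_def)
  have u_pos: "u x > 0"
    and pde: "(N - 1) / m * laplacian (\<lambda>y. u y powr m) x
           + \<beta> * (x \<bullet> gradient u x) + 2 * \<beta> / (1 - m) * u x = 0" for x
    using sol by (auto simp: entire_solution_def N_def)
  have "m > 0" using \<open>N > 2\<close> by (simp add: m)
  have am: "2 / (1 - m) = a / m"
    using \<open>N > 2\<close> by (simp add: m a field_simps)
  define \<phi> where "\<phi> = (\<lambda>t. u (t *\<^sub>R e))"
  define \<phi>' where "\<phi>' = (\<lambda>t. partial_deriv i u (t *\<^sub>R e))"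
  define \<phi>'' where "\<phi>'' = (\<lambda>t. partial_deriv i (partial_deriv i u) (t *\<^sub>R e))"
  define G where "G = (\<lambda>t. m * \<phi>' t / \<phi> t)"
  define G' where "G' = (\<lambda>t. m * (\<phi>'' t / \<phi> t - (\<phi>' t / \<phi> t)\<^sup>2))"
  define \<Phi> where "\<Phi> = (\<lambda>t. \<phi> t powr m)"
  have \<phi>_pos: "\<phi> t > 0" for t by (simp add: \<phi>_def u_pos)
  have \<phi>_deriv: "(\<phi> has_real_derivative \<phi>' t) (at t)" for t
    unfolding \<phi>_def \<phi>'_def e_def by (rule C_diff_line_derivative[OF smooth])
  have \<phi>'_deriv: "(\<phi>' has_real_derivative \<phi>'' t) (at t)" for t
    unfolding \<phi>'_def \<phi>''_def e_def
    by (rule C_diff_line_derivative[of 0]) (use smooth[of 2] in \<open>simp add: numeral_2_eq_2\<close>)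
  have \<phi>'_cont: "continuous_on UNIV \<phi>'"
    using \<phi>'_deriv by (intro continuous_at_imp_continuous_on) (auto intro: DERIV_isCont)
  have \<phi>_U: "\<phi> r = U r" if "r \<ge> 0" for r
    using rad norm_e that by (simp add: \<phi>_def radial_profile_def)
  have u_radial: "u y = \<phi> (norm y)" for y
    using rad \<phi>_U[of "norm y"] by (simp add: radial_profile_def)
  have G_deriv: "(G has_real_derivative G' t) (at t)" for t
    unfolding G_def G'_def using \<phi>_pos[of t]
    by (auto intro!: derivative_eq_intros \<phi>_deriv \<phi>'_deriv simp: field_simps power2_eq_square)
  have \<Phi>_deriv: "(\<Phi> has_real_derivative \<Phi> t * G t) (at t)" for t
  proof -
    have "(\<Phi> has_real_derivative m * \<phi> t powr (m - 1) * \<phi>' t) (at t)"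
      using DERIV_fun_powr[OF \<phi>_deriv \<phi>_pos, of m t] by (simp add: \<Phi>_def)
    moreover have "\<phi> t powr (m - 1) = \<Phi> t / \<phi> t"
      using powr_diff[of "\<phi> t" m 1] \<phi>_pos[of t] by (simp add: \<Phi>_def)
    ultimately show ?thesis by (simp add: G_def mult_ac)
  qed
  have \<Phi>'_deriv: "((\<lambda>t. \<Phi> t * G t) has_real_derivative \<Phi> t * (G' t + (G t)\<^sup>2)) (at t)" for t
    by (rule DERIV_cong[OF DERIV_mult[OF \<Phi>_deriv G_deriv]])
      (simp add: algebra_simps power2_eq_square)
  have ode: "G' r + (G r)\<^sup>2 + (N - 1) / r * G r +
      \<beta> / (N - 1) * \<phi> r powr (1 - m) * (r * G r + a) = 0" if "r > 0" for r
  proof -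
    have "r *\<^sub>R e \<noteq> 0" using norm_e that by auto
    then have "laplacian (\<lambda>y. u y powr m) (r *\<^sub>R e) =
        \<Phi> r * (G' r + (G r)\<^sup>2) + (N - 1) / r * (\<Phi> r * G r)"
      using laplacian_radial[of "\<lambda>y. u y powr m" \<Phi> "\<lambda>t. \<Phi> t * G t"
          "\<lambda>t. \<Phi> t * (G' t + (G t)\<^sup>2)" "r *\<^sub>R e"] \<Phi>_deriv \<Phi>'_deriv norm_e that
      by (simp add: u_radial \<Phi>_def N_def)
    moreover have "(r *\<^sub>R e) \<bullet> gradient u (r *\<^sub>R e) = r * \<phi>' r"
      unfolding \<phi>'_def e_def by (rule inner_gradient_axis)
    moreover have "u (r *\<^sub>R e) = \<phi> r" by (simp add: \<phi>_def)
    \<comment> \<open>This puts the zeroth-order term over \<open>m\<close> as well, so that it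
      combines with the gradient term into \<open>r * G r + a\<close>.\<close>
    moreover have "2 * \<beta> / (1 - m) = \<beta> * (a / m)" using am by (metis mult.commute times_divide_eq_right)
    moreover have "\<phi>' r = \<phi> r * G r / m"
      using \<phi>_pos[of r] \<open>m > 0\<close> by (simp add: G_def)
    ultimately have "(N - 1) / m * (\<Phi> r * (G' r + (G r)\<^sup>2) + (N - 1) / r * (\<Phi> r * G r)) +
        \<beta> * (r * (\<phi> r * G r / m)) + \<beta> * (a / m) * \<phi> r = 0"
      using pde[of "r *\<^sub>R e"] by simp
    \<comment> \<open>This splitting exposes the factor \<open>\<Phi>\<close> in the two lower-order
      terms.\<close>
    moreover have "\<phi> r = \<Phi> r * \<phi> r powr (1 - m)"
      using \<phi>_pos[of r] by (simp add: \<Phi>_def flip: powr_add)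
    ultimately have "(N - 1) / m * (\<Phi> r * (G' r + (G r)\<^sup>2) + (N - 1) / r * (\<Phi> r * G r)) +
        \<beta> * (r * (\<Phi> r * \<phi> r powr (1 - m) * G r / m)) +
        \<beta> * (a / m) * (\<Phi> r * \<phi> r powr (1 - m)) = 0"
      by metis
    also have "(N - 1) / m * (\<Phi> r * (G' r + (G r)\<^sup>2) + (N - 1) / r * (\<Phi> r * G r)) +
        \<beta> * (r * (\<Phi> r * \<phi> r powr (1 - m) * G r / m)) +
        \<beta> * (a / m) * (\<Phi> r * \<phi> r powr (1 - m)) =
        (N - 1) * \<Phi> r / m * (G' r + (G r)\<^sup>2 + (N - 1) / r * G r +
          \<beta> / (N - 1) * \<phi> r powr (1 - m) * (r * G r + a))"
      using \<open>N > 2\<close> \<open>m > 0\<close> that by (simp add: field_simps)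
    finally show ?thesis
      using \<open>N > 2\<close> \<open>m > 0\<close> \<phi>_pos[of r] by (simp add: \<Phi>_def)
  qed
  have "orbit a (\<beta> / (N - 1) * \<phi> 0 powr (1 - m))
      (\<lambda>s. \<beta> / (N - 1) * exp (2 * s) * \<phi> (exp s) powr (1 - m)) (\<lambda>s. a + exp s * G (exp s))"
    by (rule orbit_of_radial_ode[OF \<open>N > 2\<close> m a \<open>\<beta> > 0\<close> \<phi>_pos \<phi>_deriv \<phi>'_cont _ G_deriv ode])
      (simp_all add: G_def)
  then show ?thesis
    using \<phi>_U by (intro exI conjI) (auto simp: \<phi>_def)
qed

section \<open>Return from the orbit to the radial variable\<close>

theorem proposition2p6:
  fixes n :: nat and m :: real
  assumes "CARD('n::finite) = n" and "n \<ge> 3"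
    and "m = (real n - 2) / (real n + 2)"
  shows "\<exists>\<kappa>::real. \<forall>\<beta>>0. \<forall>lam>0. \<forall>(u :: real ^ 'n \<Rightarrow> real) U.
    entire_solution m \<beta> u \<and> radial_profile u U \<and> u 0 = lam \<longrightarrow>
    (\<exists>\<epsilon> \<in> o[at_top](\<lambda>r::real. 1 / ln r).
      \<forall>\<^sub>F r in at_top.
        U r powr (1 - m) =
          (real n - 1) * (real n - 2) / (\<beta> * r\<^sup>2) *
          (ln r + (2 * ln lam / (real n + 2) + ln \<beta> / 2 + \<kappa>)
            + (real n - 6) / (4 * (real n - 2)) * (1 / ln r) + \<epsilon> r))"
proof -
  define N where "N = real n"
  define a where "a = (N - 2) / 2"
  have "N > 2" using \<open>n \<ge> 3\<close> by (simp add: N_def)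
  then have "a > 0" by (simp add: a_def)
  have m: "m = (N - 2) / (N + 2)" by (simp add: assms N_def)
  obtain \<kappa>0 where \<kappa>0: "\<And>L W g. orbit a L W g \<Longrightarrow>
    ((\<lambda>s. s * (W s / (2 * a) - s - (ln L / 2 + \<kappa>0))) \<longlongrightarrow> - (2 / a - 1) / 4) at_top"
    using orbit_asymptotics by blast
  have coeff: "- (2 / a - 1) / 4 = (N - 6) / (4 * (N - 2))"
    using \<open>N > 2\<close> by (simp add: a_def field_simps)
  show ?thesis
    unfolding N_def[symmetric]
  \<comment> \<open>Since \<open>L = \<beta> / (N - 1) * lam powr (1 - m)\<close>, half its
    logarithm contributes \<open>ln \<beta> / 2\<close>, the term in \<open>ln lam\<close> with
    \<open>(1 - m) / 2 = 2 / (N + 2)\<close>, and \<open>- ln (N - 1) / 2\<close>, which is absorbed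
    into the constant.\<close>
  proof (intro exI[of _ "\<kappa>0 - ln (N - 1) / 2"] allI impI)
    fix \<beta> lam :: real and u :: "real ^ 'n \<Rightarrow> real" and U
    assume "\<beta> > 0" "lam > 0" "entire_solution m \<beta> u \<and> radial_profile u U \<and> u 0 = lam"
    then have "\<exists>W g. orbit a (\<beta> / (N - 1) * lam powr (1 - m)) W g \<and>
        (\<forall>s. W s = \<beta> / (N - 1) * exp (2 * s) * U (exp s) powr (1 - m))"
      using orbit_of_entire_solution[where u = u] \<open>N > 2\<close> m a_def by (auto simp: N_def assms(1))
    then obtain W g where o: "orbit a (\<beta> / (N - 1) * lam powr (1 - m)) W g"
      and W: "\<And>s. W s = \<beta> / (N - 1) * exp (2 * s) * U (exp s) powr (1 - m)"
      by blast
    define c where "c = 2 * ln lam / (N + 2) + ln \<beta> / 2 + (\<kappa>0 - ln (N - 1) / 2)"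
    have c: "ln (\<beta> / (N - 1) * lam powr (1 - m)) / 2 + \<kappa>0 = c"
    proof -
      have "ln (\<beta> / (N - 1) * lam powr (1 - m)) = ln \<beta> - ln (N - 1) + (1 - m) * ln lam"
        using \<open>\<beta> > 0\<close> \<open>lam > 0\<close> \<open>N > 2\<close> by (simp add: ln_mult ln_div ln_powr)
      moreover have "1 - m = 4 / (N + 2)" using \<open>N > 2\<close> by (simp add: m field_simps)
      then have "(1 - m) * ln lam = 2 * (2 * ln lam / (N + 2))" by simp
      ultimately show ?thesis unfolding c_def by linarith
    qed
    define k where "k = (N - 6) / (4 * (N - 2))"
    \<comment> \<open>The exact remainder: the expansion then holds identically for
      \<open>r > 0\<close>, and what has to be proved is that \<open>\<epsilon>\<close> is small
      compared with \<open>1 / ln r\<close>.\<close>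
    define \<epsilon> where "\<epsilon> = (\<lambda>r. W (ln r) / (2 * a) - ln r - c - k * (1 / ln r))"
    have "((\<lambda>r. ln r * (W (ln r) / (2 * a) - ln r - c)) \<longlongrightarrow> k) at_top"
      using filterlim_compose[OF \<kappa>0[OF o] ln_at_top] by (simp only: c coeff k_def)
    then have "((\<lambda>r. ln r * (W (ln r) / (2 * a) - ln r - c) - k) \<longlongrightarrow> k - k) at_top"
      by (intro tendsto_intros)
    moreover have "\<forall>\<^sub>F r in at_top. ln r * (W (ln r) / (2 * a) - ln r - c) - k = \<epsilon> r / (1 / ln r)"
      using eventually_gt_at_top[of "1::real"]
      by eventually_elim (simp add: \<epsilon>_def field_simps)
    ultimately have "((\<lambda>r. \<epsilon> r / (1 / ln r)) \<longlongrightarrow> 0) at_top"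
      by (simp add: tendsto_cong)
    moreover have "\<forall>\<^sub>F r in at_top. 1 / ln r \<noteq> (0::real)"
      using eventually_gt_at_top[of "1::real"] by eventually_elim simp
    ultimately have "\<epsilon> \<in> o(\<lambda>r. 1 / ln r)"
      by (intro smalloI_tendsto)
    moreover have "\<forall>\<^sub>F r in at_top. U r powr (1 - m) =
        (N - 1) * (N - 2) / (\<beta> * r\<^sup>2) * (ln r + c + k * (1 / ln r) + \<epsilon> r)"
      using eventually_gt_at_top[of "0::real"]
    proof eventually_elim
      case (elim r)
      have "W (ln r) = \<beta> / (N - 1) * r\<^sup>2 * U r powr (1 - m)"
        using elim by (simp add: W exp_double)
      then show ?case
        using elim \<open>\<beta> > 0\<close> \<open>N > 2\<close> by (simp add: \<epsilon>_def a_def field_simps)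
    qed
    ultimately show "\<exists>\<epsilon>\<in>o(\<lambda>r. 1 / ln r). \<forall>\<^sub>F r in at_top. U r powr (1 - m) =
        (N - 1) * (N - 2) / (\<beta> * r\<^sup>2) *
        (ln r + (2 * ln lam / (N + 2) + ln \<beta> / 2 + (\<kappa>0 - ln (N - 1) / 2)) +
         (N - 6) / (4 * (N - 2)) * (1 / ln r) + \<epsilon> r)"
      unfolding c_def k_def by blast
  qed
qed

end
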